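(* Assume $1<|\mathcal X|<|\mathcal Y|$ and $\mathcal W_\kappa(\mathcal Y,\mathcal E)\neq\emptyset$. If $(\mathcal Y,\mathcal E)$ has a multi-row merging block with respect to $\kappa$ which is redundant, then $\mathcal W_\kappa(\mathcal Y,\mathcal E)$ does not form an e-family.
   Context: Let $\mathcal Y$ be a finite set and $\mathcal E\subset\mathcal Y^2$ a nonempty edge set such that the digraph $(\mathcal Y,\mathcal E)$ is strongly connected. $\mathcal F(\mathcal Y,\mathcal E)=\mathbb R^{\mathcal E}$ is the space of real functions on $\mathcal E$, identified with real $\mathcal Y\times\mathcal Y$ matrices vanishing outside $\mathcal E$; $\mathcal F^+(\mathcal Y,\mathcal E)$ is the subset of those that are strictly positive on $\mathcal E$; $\mathcal W(\mathcal Y,\mathcal E)\subset\mathcal F^+(\mathcal Y,\mathcal E)$ is the set of row-stochastic ones. Let $\kappa\colon\mathcal Y\to\mathcal X$ be surjective, $\mathcal S_x=\kappa^{-1}(x)$, $\mathcal D=\{(\kappa(y),\kappa(y')):(y,y')\in\mathcal E\}$, and write $F(y,\mathcal S_{x'})=\sum_{y'\in\mathcal S_{x'}}F(y,y')$. $\mathcal W_\kappa(\mathcal Y,\mathcal E)$ is the set of $\kappa$-lumpable $P\in\mathcal W(\mathcal Y,\mathcal E)$, i.e. those with $P(y_1,\mathcal S_{x'})=P(y_2,\mathcal S_{x'})$ for all $(x,x')\in\mathcal D$ and $y_1,y_2\in\mathcal S_x$. Merging blocks: $(x,x')\in\mathcal D$ is a merging block of $(\mathcal Y,\mathcal E)$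 with respect to $\kappa$ if for some $y\in\mathcal S_x$ one has $|\{(y,y')\in\mathcal E: y'\in\mathcal S_{x'}\}|>1$; it is multi-row if moreover $|\mathcal S_x|\ge 2$. Redundant blocks: for $\mathcal T\subset\mathcal X$ let $\mathcal Y|_{\mathcal T}=\bigcup_{x\in\mathcal T}\mathcal S_x$ and $\mathcal E|_{\mathcal T}=\mathcal E\cap\bigcup_{x,x'\in\mathcal T}(\mathcal S_x\times\mathcal S_{x'})$. A block $(x_0,x_0')\in\mathcal D$ is redundant if there exists $\mathcal T\subset\mathcal X$ such that $(x_0,x_0')\in\mathcal T^2$ and the digraph $(\mathcal Y|_{\mathcal T},\ \mathcal E|_{\mathcal T}\setminus(\mathcal S_{x_0}\times\mathcal S_{x_0'}))$ is strongly connected. E-families: for $F\in\mathcal F^+(\mathcal Y,\mathcal E)$ with Perron–Frobenius root $\rho_F$ and positive right eigenvector $v_F$, put $\mathfrak s(F)(y,y')=\frac{F(y,y')v_F(y')}{\rho_F v_F(y)}$, so $\mathfrak s(F)\in\mathcal W(\mathcal Y,\mathcal E)$. Let $\mathcal N(\mathcal Y,\mathcal E)$ be the linear space of $N\in\mathcal F(\mathcal Y,\mathcal E)$ of the form $N(y,y')=f(y')-f(y)+c$ with $f\in\mathbb R^{\mathcal Y}$, $c\in\mathbb R$. A set $\mathcal V\subset\mathcal W(\mathcal Y,\mathcal E)$ forms an e-family (of dimension $d\ge 0$) if there are $K\in\mathcal F(\mathcal Y,\mathcal E)$ and $G_1,\dots,G_d\in\mathcal F(\mathcal Y,\mathcal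 E)$, linearly independent modulo $\mathcal N(\mathcal Y,\mathcal E)$, with $\mathcal V=\{\mathfrak s(\exp(K+\sum_{i=1}^d\theta^iG_i)):\theta\in\mathbb R^d\}$, where $\exp$ is applied entrywise on $\mathcal E$. *)

theory Defs
  imports "Graph_Theory.Digraph_Component" "HOL-Analysis.Analysis"
begin

text \<open>
  The finite vertex set is the universe of a type \<open>'y :: finite\<close>; real functions on an edge set
  \<open>E\<close> are the matrices in \<open>real ^ 'y ^ 'y\<close> that vanish outside \<open>E\<close>. The lumping map is a
  surjection \<open>\<kappa>\<close> onto the universe of a type \<open>'x :: finite\<close>.
\<close>

definition sconn :: "'a set \<Rightarrow> ('a \<times> 'a) set \<Rightarrow> bool" where
  "sconn V A \<longleftrightarrow> strongly_connected (with_proj \<lparr>pverts = V, parcs = A\<rparr>)"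

definition edge_funs :: "('y \<times> 'y) set \<Rightarrow> (real ^ 'y ^ 'y) set" where
  "edge_funs E = {F. \<forall>y y'. (y, y') \<notin> E \<longrightarrow> F $ y $ y' = 0}"

definition pos_edge_funs :: "('y \<times> 'y) set \<Rightarrow> (real ^ 'y ^ 'y) set" where
  "pos_edge_funs E = {F \<in> edge_funs E. \<forall>(y, y') \<in> E. F $ y $ y' > 0}"

definition stoch :: "('y :: finite \<times> 'y) set \<Rightarrow> (real ^ 'y ^ 'y) set" where
  "stoch E = {P \<in> pos_edge_funs E. \<forall>y. (\<Sum>y' \<in> UNIV. P $ y $ y') = 1}"


subsection \<open>Lumpability and blocks\<close>

definition fiber :: "('y \<Rightarrow> 'x) \<Rightarrow> 'x \<Rightarrow> 'y set" where
  "fiber \<kappa> x = \<kappa> -` {x}"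

definition lumped_edges :: "('y \<times> 'y) set \<Rightarrow> ('y \<Rightarrow> 'x) \<Rightarrow> ('x \<times> 'x) set" where
  "lumped_edges E \<kappa> = {(\<kappa> y, \<kappa> y') | y y'. (y, y') \<in> E}"

definition row_sum :: "real ^ 'y ^ 'y \<Rightarrow> 'y \<Rightarrow> 'y set \<Rightarrow> real" where
  "row_sum F y S = (\<Sum>y' \<in> S. F $ y $ y')"

definition lumpable :: "('y :: finite \<times> 'y) set \<Rightarrow> ('y \<Rightarrow> 'x) \<Rightarrow> (real ^ 'y ^ 'y) set" where
  "lumpable E \<kappa> = {P \<in> stoch E. \<forall>(x, x') \<in> lumped_edges E \<kappa>.
     \<forall>y1 \<in> fiber \<kappa> x. \<forall>y2 \<in> fiber \<kappa> x.
       row_sum P y1 (fiber \<kappa> x') = row_sum P y2 (fiber \<kappa> x')}"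

definition merging_block :: "('y \<times> 'y) set \<Rightarrow> ('y \<Rightarrow> 'x) \<Rightarrow> 'x \<times> 'x \<Rightarrow> bool" where
  "merging_block E \<kappa> b \<longleftrightarrow> (case b of (x, x') \<Rightarrow> (x, x') \<in> lumped_edges E \<kappa> \<and>
     (\<exists>y \<in> fiber \<kappa> x. card {(y, y') | y'. (y, y') \<in> E \<and> y' \<in> fiber \<kappa> x'} > 1))"

definition multi_row_merging_block :: "('y \<times> 'y) set \<Rightarrow> ('y \<Rightarrow> 'x) \<Rightarrow> 'x \<times> 'x \<Rightarrow> bool" where
  "multi_row_merging_block E \<kappa> b \<longleftrightarrow> merging_block E \<kappa> b \<and> card (fiber \<kappa> (fst b)) \<ge> 2"

definition restr_verts :: "('y \<Rightarrow> 'x) \<Rightarrow> 'x set \<Rightarrow> 'y set" where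
  "restr_verts \<kappa> T = (\<Union>x \<in> T. fiber \<kappa> x)"

definition restr_edges :: "('y \<times> 'y) set \<Rightarrow> ('y \<Rightarrow> 'x) \<Rightarrow> 'x set \<Rightarrow> ('y \<times> 'y) set" where
  "restr_edges E \<kappa> T = E \<inter> (\<Union>x \<in> T. \<Union>x' \<in> T. fiber \<kappa> x \<times> fiber \<kappa> x')"

definition redundant_block :: "('y \<times> 'y) set \<Rightarrow> ('y \<Rightarrow> 'x) \<Rightarrow> 'x \<times> 'x \<Rightarrow> bool" where
  "redundant_block E \<kappa> b \<longleftrightarrow> (case b of (x0, x0') \<Rightarrow> (x0, x0') \<in> lumped_edges E \<kappa> \<and>
     (\<exists>T. (x0, x0') \<in> T \<times> T \<and>
        sconn (restr_verts \<kappa> T) (restr_edges E \<kappa> T - fiber \<kappa> x0 \<times> fiber \<kappa> x0')))"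


subsection \<open>E-families\<close>

definition complex_eigenvalues :: "real ^ 'y ^ 'y \<Rightarrow> complex set" where
  "complex_eigenvalues F =
     {l. \<exists>v :: complex ^ 'y. v \<noteq> 0 \<and> (\<chi> y y'. complex_of_real (F $ y $ y')) *v v = l *s v}"

text \<open>
  The Perron--Frobenius root is the spectral radius. For a nonnegative irreducible matrix it has
  a positive right eigenvector, unique up to a positive factor that cancels in
  \<open>stoch_map\<close>, so the choice made in \<open>pf_vec\<close> is immaterial.
\<close>

definition pf_root :: "real ^ 'y ^ 'y \<Rightarrow> real" where
  "pf_root F = Sup (cmod ` complex_eigenvalues F)"

definition pf_vec :: "real ^ 'y ^ 'y \<Rightarrow> real ^ 'y" where
  "pf_vec F = (SOME v. (\<forall>y. v $ y > 0) \<and> F *v v = pf_root F *\<^sub>R v)"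

definition stoch_map :: "real ^ 'y ^ 'y \<Rightarrow> real ^ 'y ^ 'y" where
  "stoch_map F = (\<chi> y y'. F $ y $ y' * pf_vec F $ y' / (pf_root F * pf_vec F $ y))"

definition exp_on :: "('y \<times> 'y) set \<Rightarrow> real ^ 'y ^ 'y \<Rightarrow> real ^ 'y ^ 'y" where
  "exp_on E F = (\<chi> y y'. if (y, y') \<in> E then exp (F $ y $ y') else 0)"

definition null_funs :: "('y \<times> 'y) set \<Rightarrow> (real ^ 'y ^ 'y) set" where
  "null_funs E = {N \<in> edge_funs E. \<exists>(f :: 'y \<Rightarrow> real) (c :: real).
     \<forall>(y, y') \<in> E. N $ y $ y' = f y' - f y + c}"

definition indep_mod ::
  "('a :: real_vector) set \<Rightarrow> nat \<Rightarrow> (nat \<Rightarrow> 'a) \<Rightarrow> bool" where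
  "indep_mod N d G \<longleftrightarrow>
     (\<forall>a :: nat \<Rightarrow> real. (\<Sum>i<d. a i *\<^sub>R G i) \<in> N \<longrightarrow> (\<forall>i<d. a i = 0))"

text \<open>
  A parameter in \<open>\<real>\<close> to the power \<open>d\<close> is a function \<open>\<theta> :: nat \<Rightarrow> real\<close> of which only the values
  at indices below \<open>d\<close> matter.
\<close>

definition e_family_dim :: "('y :: finite \<times> 'y) set \<Rightarrow> nat \<Rightarrow> (real ^ 'y ^ 'y) set \<Rightarrow> bool" where
  "e_family_dim E d V \<longleftrightarrow> V \<subseteq> stoch E \<and>
     (\<exists>K \<in> edge_funs E. \<exists>G :: nat \<Rightarrow> real ^ 'y ^ 'y.
        (\<forall>i<d. G i \<in> edge_funs E) \<and> indep_mod (null_funs E) d G \<and>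
        V = {stoch_map (exp_on E (K + (\<Sum>i<d. \<theta> i *\<^sub>R G i))) | \<theta> :: nat \<Rightarrow> real. True})"

definition e_family :: "('y :: finite \<times> 'y) set \<Rightarrow> (real ^ 'y ^ 'y) set \<Rightarrow> bool" where
  "e_family E V \<longleftrightarrow> (\<exists>d. e_family_dim E d V)"

end

theory Submission
  imports Defs
begin

text \<open>
  An e-family is closed under entrywise geometric means up to a diagonal similarity: the exponents
  of two members may be averaged, and \<open>stoch_map\<close> changes a matrix only by a diagonal similarity
  and a positive factor (\<open>e_family_geometric_mean\<close>). The proof exhibits two lumpable matrices whose
  geometric mean cannot be made lumpable in this way.

  Let \<open>(x\<^sub>0, x\<^sub>0')\<close> be the redundant multi-row merging block, let \<open>y\<^sub>1\<close> be a row with at least two edges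
  in it, and let \<open>y\<^sub>2\<close> be another row over \<open>x\<^sub>0\<close>. Moving mass between two entries of the row \<open>y\<^sub>1\<close>
  inside the block turns a lumpable \<open>P\<close> into a lumpable \<open>P'\<close> with the same lumped matrix \<open>Q\<close>.
  In the geometric mean of \<open>P\<close> and \<open>P'\<close> the block row of \<open>y\<^sub>2\<close> still sums to \<open>Q(x\<^sub>0, x\<^sub>0')\<close>, but
  that of \<open>y\<^sub>1\<close> sums to some \<open>Z < Q(x\<^sub>0, x\<^sub>0')\<close>, because the inequality of arithmetic and geometric
  means is strict where \<open>P\<close> and \<open>P'\<close> differ.

  It remains to prevent the diagonal similarity, given by a positive vector \<open>u\<close>, from repairing this
  defect, and here redundancy enters. Let \<open>T\<close> witness it and let \<open>V\<close> be the set of vertices over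
  \<open>T\<close>. Multiplying each block of \<open>P\<close> and \<open>P'\<close> by a constant, one can arrange that from \<open>V\<close> almost
  all mass, up to a small \<open>e\<close>, stays in \<open>V\<close> and avoids the block \<open>(x\<^sub>0, x\<^sub>0')\<close>. Block constants
  preserve lumpability and the ratio \<open>Z / Q(x\<^sub>0, x\<^sub>0')\<close>. The vector \<open>u\<close> is an eigenvector of the
  geometric mean \<open>F\<close>, with eigenvalue at most 1 since \<open>F\<close> is substochastic. So on \<open>V\<close> it is
  superharmonic for a kernel that is stochastic up to \<open>e\<close>. As \<open>V\<close> stays
  strongly connected without the block, a minimum principle propagated along paths gives
  \<open>max\<^sub>V u \<le> (1 + C e) min\<^sub>V u\<close> with \<open>C\<close> independent of \<open>e\<close> (\<open>almost_superharmonic_bound\<close>).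
  Lumpability of the block would then force \<open>Q(x\<^sub>0, x\<^sub>0') \<le> Z (1 + C e)\<^sup>2\<close>, which fails for small \<open>e\<close>.
\<close>

section \<open>Reachability and strict mean inequality\<close>

lemma sconn_rtrancl:
  assumes "sconn V A" "a \<in> V" "b \<in> V"
  shows "(a, b) \<in> A\<^sup>*"
proof -
  let ?G = "with_proj \<lparr>pverts = V, parcs = A\<rparr>"
  have "\<forall>u\<in>verts ?G. \<forall>v\<in>verts ?G. u \<rightarrow>\<^sup>*\<^bsub>?G\<^esub> v"
    using assms(1) unfolding sconn_def strongly_connected_def by (rule conjunct2)
  then have "a \<rightarrow>\<^sup>*\<^bsub>?G\<^esub> b"
    using assms(2,3) by simp
  then have "(a, b) \<in> (arcs_ends ?G)\<^sup>*"
    unfolding reachable_def by (rule rtrancl_on_rtranclI)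
  moreover have "arcs_ends ?G = A"
    by (auto simp: arcs_ends_def arc_to_ends_def)
  ultimately show ?thesis by simp
qed

lemma sqrt_mult_less_mean:
  fixes x y :: real
  assumes "0 \<le> x" "0 \<le> y" "x \<noteq> y"
  shows "sqrt (x * y) < (x + y) / 2"
proof (rule real_less_lsqrt)
  have "0 < (x - y)\<^sup>2" using assms by simp
  then show "x * y < ((x + y) / 2)\<^sup>2"
    by (simp add: power2_eq_square field_simps)
qed (use assms in auto)

section \<open>Lumpable matrices\<close>

lemma edge_pos: "P \<in> stoch E \<Longrightarrow> (y, y') \<in> E \<Longrightarrow> 0 < P $ y $ y'"
  by (auto simp: stoch_def pos_edge_funs_def)

lemma nonedge_zero: "P \<in> stoch E \<Longrightarrow> (y, y') \<notin> E \<Longrightarrow> P $ y $ y' = 0"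
  by (auto simp: stoch_def pos_edge_funs_def edge_funs_def)

lemma stoch_nonneg: "P \<in> stoch E \<Longrightarrow> 0 \<le> P $ y $ y'"
  by (cases "(y, y') \<in> E") (auto simp: edge_pos nonedge_zero intro: less_imp_le)

text \<open>
  The definition of lumpability only speaks of blocks that contain an edge. On all other blocks
  the row sums vanish, so the lumped matrix \<open>Q\<close> exists without a side condition.
\<close>

lemma lumpable_iff:
  "P \<in> lumpable E \<kappa> \<longleftrightarrow> P \<in> stoch E \<and> (\<exists>Q. \<forall>y x'. row_sum P y (fiber \<kappa> x') = Q (\<kappa> y) x')"
proof (intro iffI conjI)
  assume P: "P \<in> lumpable E \<kappa>"
  then show st: "P \<in> stoch E" by (simp add: lumpable_def)
  have eq: "row_sum P y1 (fiber \<kappa> x') = row_sum P y2 (fiber \<kappa> x')" if "\<kappa> y1 = \<kappa> y2" for y1 y2 x'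
  proof (cases "(\<kappa> y1, x') \<in> lumped_edges E \<kappa>")
    case True
    then have "\<forall>z1\<in>fiber \<kappa> (\<kappa> y1). \<forall>z2\<in>fiber \<kappa> (\<kappa> y1).
        row_sum P z1 (fiber \<kappa> x') = row_sum P z2 (fiber \<kappa> x')"
      using P unfolding lumpable_def by blast
    moreover have "y1 \<in> fiber \<kappa> (\<kappa> y1)" "y2 \<in> fiber \<kappa> (\<kappa> y1)"
      using that by (simp_all add: fiber_def)
    ultimately show ?thesis by blast
  next
    case False
    then have "row_sum P y (fiber \<kappa> x') = 0" if "\<kappa> y = \<kappa> y1" for y
      unfolding row_sum_def using that
      by (intro sum.neutral ballI nonedge_zero[OF st]) (use False in \<open>auto simp: lumped_edges_def fiber_def\<close>)
    then show ?thesis using that by simp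
  qed
  have some: "\<kappa> (SOME z. \<kappa> z = \<kappa> y) = \<kappa> y" for y
    by (rule someI[of "\<lambda>z. \<kappa> z = \<kappa> y"]) (rule refl)
  show "\<exists>Q. \<forall>y x'. row_sum P y (fiber \<kappa> x') = Q (\<kappa> y) x'"
    by (rule exI[of _ "\<lambda>x x'. row_sum P (SOME y. \<kappa> y = x) (fiber \<kappa> x')"])
      (intro allI eq, rule some[symmetric])
next
  assume "P \<in> stoch E \<and> (\<exists>Q. \<forall>y x'. row_sum P y (fiber \<kappa> x') = Q (\<kappa> y) x')"
  then show "P \<in> lumpable E \<kappa>"
    by (auto simp: lumpable_def fiber_def)
qed

lemma sum_fibers:
  fixes \<kappa> :: "'y :: finite \<Rightarrow> 'x :: finite" and f :: "'y \<Rightarrow> real"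
  shows "(\<Sum>x\<in>UNIV. \<Sum>y\<in>fiber \<kappa> x. f y) = (\<Sum>y\<in>UNIV. f y)"
proof -
  have "{y \<in> UNIV. \<kappa> y = x} = fiber \<kappa> x" for x by (auto simp: fiber_def)
  then show ?thesis using sum.group[of UNIV UNIV \<kappa> f] by simp
qed

lemma sum_block_weights:
  fixes P :: "real ^ 'y ^ 'y" and \<kappa> :: "'y :: finite \<Rightarrow> 'x :: finite"
  assumes "\<And>y x'. row_sum P y (fiber \<kappa> x') = Q (\<kappa> y) x'"
  shows "(\<Sum>y'\<in>UNIV. g (\<kappa> y') * P $ y $ y') = (\<Sum>x'\<in>UNIV. g x' * Q (\<kappa> y) x')"
proof -
  have "(\<Sum>y'\<in>UNIV. g (\<kappa> y') * P $ y $ y') = (\<Sum>x'\<in>UNIV. \<Sum>y'\<in>fiber \<kappa> x'. g (\<kappa> y') * P $ y $ y')"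
    by (rule sum_fibers[symmetric])
  also have "\<dots> = (\<Sum>x'\<in>UNIV. g x' * Q (\<kappa> y) x')"
  proof (rule sum.cong[OF refl])
    fix x'
    have "(\<Sum>y'\<in>fiber \<kappa> x'. g (\<kappa> y') * P $ y $ y') = g x' * row_sum P y (fiber \<kappa> x')"
      unfolding row_sum_def sum_distrib_left by (rule sum.cong) (auto simp: fiber_def)
    then show "(\<Sum>y'\<in>fiber \<kappa> x'. g (\<kappa> y') * P $ y $ y') = g x' * Q (\<kappa> y) x'"
      using assms by simp
  qed
  finally show ?thesis .
qed

text \<open>
  The lumped matrix of a lumpable matrix can be changed at will, on the same support, while the
  conditional distributions inside the blocks are kept.
\<close>

lemma lumpable_reweight:
  fixes P :: "real ^ 'y ^ 'y" and \<kappa> :: "'y :: finite \<Rightarrow> 'x :: finite"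
  assumes P: "P \<in> stoch E" and Q: "\<And>y x'. row_sum P y (fiber \<kappa> x') = Q (\<kappa> y) x'"
    and g: "\<And>x x'. 0 < g x x'" "\<And>y. (\<Sum>x'\<in>UNIV. g (\<kappa> y) x' * Q (\<kappa> y) x') = 1"
  shows "(\<chi> y y'. g (\<kappa> y) (\<kappa> y') * P $ y $ y') \<in> lumpable E \<kappa>"
proof -
  let ?P = "(\<chi> y y'. g (\<kappa> y) (\<kappa> y') * P $ y $ y') :: real ^ 'y ^ 'y"
  have "?P \<in> stoch E"
    using P g sum_block_weights[OF Q]
    by (auto simp: stoch_def pos_edge_funs_def edge_funs_def)
  moreover have "row_sum ?P y (fiber \<kappa> x') = g (\<kappa> y) x' * Q (\<kappa> y) x'" for y x'
    unfolding Q[symmetric] row_sum_def sum_distrib_left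
    by (rule sum.cong) (auto simp: fiber_def)
  ultimately show ?thesis
    unfolding lumpable_iff by (intro conjI exI[of _ "\<lambda>x x'. g x x' * Q x x'"]) auto
qed

text \<open>
  Conversely, the conditional distribution of a block row with at least two edges can be changed
  without changing the lumped matrix. Half of the mass on the edge to \<open>b\<close> goes to the edge to \<open>a\<close>;
  a half keeps both entries positive.
\<close>

lemma transfer_mass:
  fixes P :: "real ^ 'y ^ 'y" and \<kappa> :: "'y :: finite \<Rightarrow> 'x :: finite"
  assumes P: "P \<in> stoch E" and E: "(y1, a) \<in> E" "(y1, b) \<in> E" and "a \<noteq> b" "\<kappa> a = \<kappa> b"
  obtains P' where "P' \<in> stoch E"
    "\<And>y x'. row_sum P' y (fiber \<kappa> x') = row_sum P y (fiber \<kappa> x')"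
    "\<And>y y'. (y, \<kappa> y') \<noteq> (y1, \<kappa> a) \<Longrightarrow> P' $ y $ y' = P $ y $ y'"
    "P' $ y1 $ b \<noteq> P $ y1 $ b"
proof -
  define h where "h = P $ y1 $ b / 2"
  define P' where "P' = (\<chi> y y'. P $ y $ y' +
    (if y = y1 then (if y' = a then h else 0) - (if y' = b then h else 0) else 0))"
  have h: "h > 0" using edge_pos[OF P E(2)] by (simp add: h_def)
  have sums: "(\<Sum>y'\<in>S. P' $ y $ y') = (\<Sum>y'\<in>S. P $ y $ y')" if "a \<in> S \<longleftrightarrow> b \<in> S" for y S
  proof (cases "y = y1")
    case True
    have "(\<Sum>y'\<in>S. P' $ y $ y') = (\<Sum>y'\<in>S. P $ y $ y') +
        ((\<Sum>y'\<in>S. if y' = a then h else 0) - (\<Sum>y'\<in>S. if y' = b then h else 0))"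
      unfolding sum_subtractf[symmetric] sum.distrib[symmetric] by (simp add: P'_def True)
    also have "\<dots> = (\<Sum>y'\<in>S. P $ y $ y')"
      using that by (cases "a \<in> S") simp_all
    finally show ?thesis .
  qed (simp add: P'_def)
  have "0 < P' $ y $ y'" if "(y, y') \<in> E" for y y'
    using edge_pos[OF P that] h \<open>a \<noteq> b\<close> by (auto simp: P'_def h_def)
  moreover have "P' $ y $ y' = 0" if "(y, y') \<notin> E" for y y'
    using nonedge_zero[OF P that] that E by (auto simp: P'_def)
  moreover have "(\<Sum>y'\<in>UNIV. P' $ y $ y') = 1" for y
    using sums[of UNIV] P by (simp add: stoch_def)
  ultimately have "P' \<in> stoch E"
    by (auto simp: stoch_def pos_edge_funs_def edge_funs_def)
  moreover have "row_sum P' y (fiber \<kappa> x') = row_sum P y (fiber \<kappa> x')" for y x'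
    unfolding row_sum_def using \<open>\<kappa> a = \<kappa> b\<close> by (intro sums) (auto simp: fiber_def)
  moreover have "(y, \<kappa> y') \<noteq> (y1, \<kappa> a) \<Longrightarrow> P' $ y $ y' = P $ y $ y'" for y y'
    using \<open>\<kappa> a = \<kappa> b\<close> by (auto simp: P'_def)
  moreover have "P' $ y1 $ b \<noteq> P $ y1 $ b"
    using \<open>a \<noteq> b\<close> h by (simp add: P'_def)
  ultimately show ?thesis using that by blast
qed

section \<open>Geometric means in e-families\<close>

text \<open>
  Since \<open>stoch_map F\<close> has row sums 1, its denominators cannot vanish, and since it is nonnegative it
  equals its entrywise absolute value. Thus the absolute values of the chosen root and vector are
  positive and give the same diagonal similarity.
\<close>

lemma stoch_map_positive_form:
  assumes "stoch_map F \<in> stoch E" and "\<And>y y'. 0 \<le> F $ y $ y'"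
  obtains w r where "\<And>y. 0 < w y" "0 < r"
    "\<And>y y'. stoch_map F $ y $ y' = F $ y $ y' * w y' / (r * w y)"
proof -
  let ?v = "pf_vec F" and ?r = "pf_root F"
  have nz: "?r * ?v $ y \<noteq> 0" for y
  proof
    assume "?r * ?v $ y = 0"
    then have "(\<Sum>y'\<in>UNIV. stoch_map F $ y $ y') = 0"
      by (auto simp: stoch_map_def)
    with assms(1) show False by (simp add: stoch_def)
  qed
  have "stoch_map F $ y $ y' = F $ y $ y' * \<bar>?v $ y'\<bar> / (\<bar>?r\<bar> * \<bar>?v $ y\<bar>)" for y y'
  proof -
    have "stoch_map F $ y $ y' = \<bar>stoch_map F $ y $ y'\<bar>"
      using stoch_nonneg[OF assms(1)] by simp
    also have "\<dots> = F $ y $ y' * \<bar>?v $ y'\<bar> / (\<bar>?r\<bar> * \<bar>?v $ y\<bar>)"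
      using assms(2) by (simp add: stoch_map_def abs_mult)
    finally show ?thesis .
  qed
  moreover have "0 < \<bar>?v $ y\<bar>" for y using nz[of y] by simp
  moreover have "0 < \<bar>?r\<bar>" using nz by simp
  ultimately show ?thesis using that[of "\<lambda>y. \<bar>?v $ y\<bar>" "\<bar>?r\<bar>"] by blast
qed

text \<open>
  The midpoint of two parameters gives the entrywise geometric mean of the two exponentials. The
  vector \<open>u\<close> collects the three eigenvectors involved, and \<open>s\<close> the three roots.
\<close>

lemma e_family_geometric_mean:
  assumes V: "e_family E V" and "P0 \<in> V" "P1 \<in> V"
  obtains u s where "\<And>y. 0 < u y" "0 < s"
    "(\<chi> y y'. sqrt (P0 $ y $ y' * P1 $ y $ y') * u y' / (s * u y)) \<in> V"
proof -
  obtain d K G where VE: "V \<subseteq> stoch E"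
    and Veq: "V = {stoch_map (exp_on E (K + (\<Sum>i<d. \<theta> i *\<^sub>R G i))) | \<theta> :: nat \<Rightarrow> real. True}"
    using V unfolding e_family_def e_family_dim_def by blast
  define F where "F \<theta> = exp_on E (K + (\<Sum>i<d. \<theta> i *\<^sub>R G i))" for \<theta> :: "nat \<Rightarrow> real"
  have Veq': "V = range (\<lambda>\<theta>. stoch_map (F \<theta>))" unfolding Veq F_def by auto
  have F0: "0 \<le> F \<theta> $ y $ y'" for \<theta> y y' by (simp add: F_def exp_on_def)
  have form: "\<exists>w r. (\<forall>y. 0 < w y) \<and> 0 < r \<and>
      (\<forall>y y'. stoch_map (F \<theta>) $ y $ y' = F \<theta> $ y $ y' * w y' / (r * w y))" for \<theta>
  proof -
    have "stoch_map (F \<theta>) \<in> stoch E" using VE Veq' by blast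
    from stoch_map_positive_form[OF this F0] show ?thesis by metis
  qed
  obtain \<theta>0 \<theta>1 where \<theta>: "P0 = stoch_map (F \<theta>0)" "P1 = stoch_map (F \<theta>1)"
    using assms(2,3) Veq' by blast
  define \<theta> where "\<theta> i = (\<theta>0 i + \<theta>1 i) / 2" for i
  have mean: "F \<theta> $ y $ y' = sqrt (F \<theta>0 $ y $ y' * F \<theta>1 $ y $ y')" for y y'
  proof -
    have lin: "2 * (\<Sum>i<d. \<theta> i * G i $ y $ y')
        = (\<Sum>i<d. \<theta>0 i * G i $ y $ y') + (\<Sum>i<d. \<theta>1 i * G i $ y $ y')"
      unfolding sum_distrib_left sum.distrib[symmetric]
      by (rule sum.cong) (simp_all add: \<theta>_def algebra_simps)
    have "F \<theta>0 $ y $ y' * F \<theta>1 $ y $ y' = (F \<theta> $ y $ y')\<^sup>2"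
      using lin by (simp add: F_def exp_on_def power2_eq_square exp_add[symmetric])
    then show ?thesis using F0 by simp
  qed
  obtain w r where w: "\<And>y. 0 < w y" "0 < r"
    and Pm: "\<And>y y'. stoch_map (F \<theta>) $ y $ y' = F \<theta> $ y $ y' * w y' / (r * w y)"
    using form by metis
  obtain w0 r0 where w0: "\<And>y. 0 < w0 y" "0 < r0"
    and P0: "\<And>y y'. P0 $ y $ y' = F \<theta>0 $ y $ y' * w0 y' / (r0 * w0 y)"
    using form \<theta> by metis
  obtain w1 r1 where w1: "\<And>y. 0 < w1 y" "0 < r1"
    and P1: "\<And>y y'. P1 $ y $ y' = F \<theta>1 $ y $ y' * w1 y' / (r1 * w1 y)"
    using form \<theta> by metis
  define u where "u y = w y / sqrt (w0 y * w1 y)" for y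
  define s where "s = r / sqrt (r0 * r1)"
  have "stoch_map (F \<theta>) $ y $ y' = sqrt (P0 $ y $ y' * P1 $ y $ y') * u y' / (s * u y)" for y y'
  proof -
    have *: "sqrt (P0 $ y $ y' * P1 $ y $ y')
        = F \<theta> $ y $ y' * sqrt (w0 y' * w1 y') / (sqrt (r0 * r1) * sqrt (w0 y * w1 y))"
      unfolding P0 P1 mean by (simp add: real_sqrt_mult real_sqrt_divide mult_ac)
    have cancel: "x * v' / (t * v) = x * \<beta> / (\<gamma> * \<alpha>) * (v' / \<beta>) / (t / \<gamma> * (v / \<alpha>))"
      if "\<alpha> \<noteq> 0" "\<beta> \<noteq> 0" "\<gamma> \<noteq> 0" for x v v' t \<alpha> \<beta> \<gamma> :: real
      using that by simp
    have "w0 z * w1 z > 0" for z using w0 w1 by simp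
    moreover have "r0 * r1 > 0" using w0 w1 by simp
    ultimately show ?thesis
      unfolding Pm * u_def s_def by (intro cancel) (metis less_irrefl real_sqrt_eq_zero_cancel_iff)+
  qed
  then have "(\<chi> y y'. sqrt (P0 $ y $ y' * P1 $ y $ y') * u y' / (s * u y)) = stoch_map (F \<theta>)"
    by (simp add: vec_eq_iff)
  then have "(\<chi> y y'. sqrt (P0 $ y $ y' * P1 $ y $ y') * u y' / (s * u y)) \<in> V"
    using Veq' by auto
  moreover have "\<And>y. 0 < u y" "0 < s"
    using w w0 w1 by (simp_all add: u_def s_def)
  ultimately show ?thesis using that by blast
qed

section \<open>Almost superharmonic functions\<close>

text \<open>
  Here \<open>F\<close> is a nonnegative kernel that loses at most the mass \<open>e\<close> outside \<open>V\<close>. The lower bound \<open>c\<close>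
  on the edges \<open>R\<close> is a separate parameter because the constants below must be uniform in \<open>e\<close>
  and \<open>F\<close>. The function \<open>u\<close> is normalized by the lower bound 1.
\<close>

definition almost_superharmonic ::
  "'y set \<Rightarrow> ('y \<times> 'y) set \<Rightarrow> ('y \<Rightarrow> 'y \<Rightarrow> real) \<Rightarrow> real \<Rightarrow> ('y \<Rightarrow> 'y \<Rightarrow> real) \<Rightarrow> ('y \<Rightarrow> real) \<Rightarrow> bool"
  where "almost_superharmonic V R c e F u \<longleftrightarrow> 0 \<le> e \<and> (\<forall>y y'. 0 \<le> F y y') \<and>
    (\<forall>(y, y') \<in> R. c y y' \<le> F y y') \<and> (\<forall>y\<in>V. 1 - e \<le> (\<Sum>y'\<in>V. F y y')) \<and>
    (\<forall>y\<in>V. 1 \<le> u y \<and> (\<Sum>y'\<in>V. F y y' * u y') \<le> u y)"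

text \<open>
  A quantitative minimum principle: where \<open>u\<close> is close to its lower bound 1, superharmonicity makes it
  close to 1 at every \<open>R\<close>-successor, with a loss factor governed by \<open>c\<close>. Along a path the factors
  accumulate to a constant that depends only on the path and on \<open>c\<close>.
\<close>

lemma almost_superharmonic_path:
  assumes "(a, b) \<in> R\<^sup>*" and "a \<in> V" and fin: "finite V" and R: "R \<subseteq> V \<times> V"
    and c: "\<And>y y'. (y, y') \<in> R \<Longrightarrow> 0 < c y y'"
  shows "\<exists>C>0. \<forall>e F u. almost_superharmonic V R c e F u \<longrightarrow> u b - 1 \<le> C * (u a - 1 + e)"
  using assms(1)
proof (induction rule: rtrancl_induct)
  case base
  show ?case by (rule exI[of _ 1]) (auto simp: almost_superharmonic_def)
next
  case (step b b')
  then obtain C where C: "C > 0"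
    and IH: "\<And>e F u. almost_superharmonic V R c e F u \<Longrightarrow> u b - 1 \<le> C * (u a - 1 + e)" by blast
  have cb: "0 < c b b'" and V: "b \<in> V" "b' \<in> V" using step c R by auto
  show ?case
  proof (intro exI[of _ "(C + 1) / c b b'"] conjI allI impI)
    fix e F u assume u: "almost_superharmonic V R c e F u"
    have F: "c b b' \<le> F b b'" "0 \<le> e" "1 - e \<le> (\<Sum>y'\<in>V. F b y')" "1 \<le> u a" "1 \<le> u b'"
      "(\<Sum>y'\<in>V. F b y' * u y') \<le> u b"
      using u V \<open>a \<in> V\<close> step by (auto simp: almost_superharmonic_def)
    \<comment> \<open>Averaging \<open>u - 1 \<ge> 0\<close> over \<open>F b\<close> loses nothing but the defect \<open>e\<close>, and a single term is
        bounded by the average.\<close>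
    have "c b b' * (u b' - 1) \<le> F b b' * (u b' - 1)"
      using F by (intro mult_right_mono) auto
    also have "\<dots> \<le> (\<Sum>y'\<in>V. F b y' * (u y' - 1))"
      using u V fin by (intro member_le_sum) (auto simp: almost_superharmonic_def)
    also have "\<dots> = (\<Sum>y'\<in>V. F b y' * u y') - (\<Sum>y'\<in>V. F b y')"
      by (simp add: algebra_simps sum_subtractf)
    also have "\<dots> \<le> C * (u a - 1 + e) + e"
      using F IH[OF u] by linarith
    also have "\<dots> \<le> (C + 1) * (u a - 1 + e)"
      using F by (simp add: algebra_simps)
    finally show "u b' - 1 \<le> (C + 1) / c b b' * (u a - 1 + e)"
      using cb by (simp add: field_simps)
  qed (use C cb in auto)
qed

lemma almost_superharmonic_bound:
  fixes V :: "'y :: finite set"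
  assumes conn: "\<And>a b. a \<in> V \<Longrightarrow> b \<in> V \<Longrightarrow> (a, b) \<in> R\<^sup>*" and R: "R \<subseteq> V \<times> V"
    and c: "\<And>y y'. (y, y') \<in> R \<Longrightarrow> 0 < c y y'"
  obtains C where "C > 0" "\<And>e F u a b. almost_superharmonic V R c e F u \<Longrightarrow>
    a \<in> V \<Longrightarrow> u a = 1 \<Longrightarrow> b \<in> V \<Longrightarrow> u b \<le> 1 + C * e"
proof -
  have "\<forall>p\<in>V \<times> V. \<exists>C>0. \<forall>e F u. almost_superharmonic V R c e F u \<longrightarrow>
      u (snd p) - 1 \<le> C * (u (fst p) - 1 + e)"
    using almost_superharmonic_path[OF conn _ finite R c] by auto
  from bchoice[OF this] obtain C where CC: "\<forall>p\<in>V \<times> V. 0 < C p \<and>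
      (\<forall>e F u. almost_superharmonic V R c e F u \<longrightarrow> u (snd p) - 1 \<le> C p * (u (fst p) - 1 + e))" ..
  then have C: "\<And>p. p \<in> V \<times> V \<Longrightarrow> 0 < C p" by blast
  have le: "u (snd p) - 1 \<le> C p * (u (fst p) - 1 + e)"
    if "p \<in> V \<times> V" "almost_superharmonic V R c e F u" for p e F u
    using CC that by blast
  \<comment> \<open>The sum serves as an upper bound for the finitely many constants.\<close>
  define M where "M = 1 + (\<Sum>p\<in>V \<times> V. C p)"
  have "M > 0" unfolding M_def by (intro add_pos_nonneg sum_nonneg) (auto intro: C less_imp_le)
  moreover have "u b \<le> 1 + M * e"
    if u: "almost_superharmonic V R c e F u" and "a \<in> V" "u a = 1" "b \<in> V" for e F u a b
  proof -
    have "u b - 1 \<le> C (a, b) * e" using le[OF _ u, of "(a, b)"] that by auto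
    also have "\<dots> \<le> M * e"
    proof (rule mult_right_mono)
      have "C (a, b) \<le> (\<Sum>p\<in>V \<times> V. C p)"
        using that C by (intro member_le_sum) (auto intro: less_imp_le)
      then show "C (a, b) \<le> M" by (simp add: M_def)
      show "0 \<le> e" using u by (simp add: almost_superharmonic_def)
    qed
    finally show ?thesis by simp
  qed
  ultimately show ?thesis using that by blast
qed

text \<open>Evaluate the eigenvalue equation at a maximum of the positive eigenvector.\<close>

lemma eigenvalue_le_one:
  fixes u :: "'y :: finite \<Rightarrow> real"
  assumes "\<And>y y'. 0 \<le> F y y'" "\<And>y. (\<Sum>y'\<in>UNIV. F y y') \<le> 1" "\<And>y. 0 < u y"
    and eig: "\<And>y. (\<Sum>y'\<in>UNIV. F y y' * u y') = s * u y"
  shows "s \<le> 1"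
proof -
  obtain y where y: "\<And>z. u z \<le> u y"
    using Max_in[of "range u"] Max_ge[of "range u"] by fastforce
  have "s * u y \<le> (\<Sum>y'\<in>UNIV. F y y' * u y)"
    unfolding eig[symmetric] using assms(1) y by (intro sum_mono mult_left_mono) auto
  also have "\<dots> \<le> 1 * u y"
    unfolding sum_distrib_right[symmetric] using assms(2,3)
    by (intro mult_right_mono) (auto intro: less_imp_le)
  finally show ?thesis using assms(3) by simp
qed

section \<open>Redundant multi-row merging blocks\<close>

theorem theorem4p1:
  fixes E :: "('y :: finite \<times> 'y) set" and \<kappa> :: "'y \<Rightarrow> 'x :: finite"
  assumes "E \<noteq> {}" and "sconn (UNIV :: 'y set) E" and "surj \<kappa>"
    and "1 < CARD('x)" and "CARD('x) < CARD('y)"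
    and "lumpable E \<kappa> \<noteq> {}"
    and "\<exists>b. multi_row_merging_block E \<kappa> b \<and> redundant_block E \<kappa> b"
  shows "\<not> e_family E (lumpable E \<kappa>)"
proof
  assume efam: "e_family E (lumpable E \<kappa>)"
  obtain x0 x0' T where merging: "merging_block E \<kappa> (x0, x0')" and multi: "2 \<le> card (fiber \<kappa> x0)"
    and T: "x0 \<in> T" "x0' \<in> T"
    and conn: "sconn (restr_verts \<kappa> T) (restr_edges E \<kappa> T - fiber \<kappa> x0 \<times> fiber \<kappa> x0')"
    using assms(7) by (auto simp: multi_row_merging_block_def redundant_block_def)
  \<comment> \<open>\<open>J\<close> marks the blocks over \<open>T\<close> other than \<open>(x0, x0')\<close>; redundancy says that their edges \<open>R\<close>
      connect \<open>V\<close> strongly.\<close>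
  define V where "V = {y. \<kappa> y \<in> T}"
  define J where "J x x' \<longleftrightarrow> x \<in> T \<and> x' \<in> T \<and> (x, x') \<noteq> (x0, x0')" for x x'
  define R where "R = {(y, y') \<in> E. J (\<kappa> y) (\<kappa> y')}"
  have RV: "restr_verts \<kappa> T = V" "restr_edges E \<kappa> T - fiber \<kappa> x0 \<times> fiber \<kappa> x0' = R"
    by (auto simp: restr_verts_def restr_edges_def V_def R_def J_def fiber_def)
  have reach: "(a, b) \<in> R\<^sup>*" if "a \<in> V" "b \<in> V" for a b
    using sconn_rtrancl[OF conn] that unfolding RV by blast
  obtain y1 where y1: "\<kappa> y1 = x0"
    and "1 < card {(y1, y') | y'. (y1, y') \<in> E \<and> y' \<in> fiber \<kappa> x0'}"
    using merging by (auto simp: merging_block_def fiber_def)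
  then have "\<not> card {(y1, y') | y'. (y1, y') \<in> E \<and> y' \<in> fiber \<kappa> x0'} \<le> Suc 0" by simp
  then obtain a b where ab: "(y1, a) \<in> E" "(y1, b) \<in> E" "a \<noteq> b" "\<kappa> a = x0'" "\<kappa> b = x0'"
    unfolding card_le_Suc0_iff_eq[OF finite] by (auto simp: fiber_def)
  have "fiber \<kappa> x0 \<noteq> {y1}" using multi by auto
  then obtain y2 where y2: "\<kappa> y2 = x0" "y2 \<noteq> y1"
    using y1 by (auto simp: fiber_def)
  have V12: "y1 \<in> V" "y2 \<in> V" using T y1 y2 by (auto simp: V_def)

  \<comment> \<open>Two lumpable matrices with the same lumped matrix that differ in the block row of \<open>y1\<close>.\<close>
  obtain P where "P \<in> lumpable E \<kappa>" using assms(6) by blast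
  then obtain Q where P: "P \<in> stoch E" and Q: "\<And>y x'. row_sum P y (fiber \<kappa> x') = Q (\<kappa> y) x'"
    unfolding lumpable_iff by blast
  obtain P' where P': "P' \<in> stoch E" and Q': "\<And>y x'. row_sum P' y (fiber \<kappa> x') = Q (\<kappa> y) x'"
    and same: "\<And>y y'. (y, \<kappa> y') \<noteq> (y1, x0') \<Longrightarrow> P' $ y $ y' = P $ y $ y'"
    and differ: "P' $ y1 $ b \<noteq> P $ y1 $ b"
    using transfer_mass[OF P ab(1,2,3), of \<kappa>] ab(4,5) Q by metis
  note nonneg = stoch_nonneg[OF P] stoch_nonneg[OF P']
  have sumQ: "(\<Sum>x'\<in>UNIV. Q (\<kappa> y) x') = 1" for y
    using sum_block_weights[OF Q, of "\<lambda>_. 1"] P by (simp add: stoch_def)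
  have Q0: "0 \<le> Q (\<kappa> y) x'" for y x'
    unfolding Q[symmetric] row_sum_def by (intro sum_nonneg nonneg)

  define Z where "Z = (\<Sum>y'\<in>fiber \<kappa> x0'. sqrt (P $ y1 $ y' * P' $ y1 $ y'))"
  have ZQ: "Z < Q x0 x0'"
  proof -
    have "Z < (\<Sum>y'\<in>fiber \<kappa> x0'. (P $ y1 $ y' + P' $ y1 $ y') / 2)"
      unfolding Z_def
    proof (rule sum_strict_mono_ex1)
      show "\<exists>y'\<in>fiber \<kappa> x0'. sqrt (P $ y1 $ y' * P' $ y1 $ y') < (P $ y1 $ y' + P' $ y1 $ y') / 2"
        using sqrt_mult_less_mean[OF nonneg] differ ab(5)
        by (intro bexI[of _ b]) (auto simp: fiber_def)
    qed (use nonneg arith_geo_mean_sqrt in auto)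
    also have "\<dots> = (row_sum P y1 (fiber \<kappa> x0') + row_sum P' y1 (fiber \<kappa> x0')) / 2"
      by (simp add: row_sum_def sum.distrib sum_divide_distrib add_divide_distrib)
    finally show ?thesis using Q Q' y1 by simp
  qed

  \<comment> \<open>The mass sent through blocks in \<open>J\<close>. It is positive over \<open>T\<close>: since \<open>V\<close> contains both \<open>y1\<close>
      and \<open>y2\<close>, every vertex of \<open>V\<close> must leave for another one along \<open>R\<close>.\<close>
  define q where "q x = (\<Sum>x'\<in>UNIV. (if J x x' then 1 else 0) * Q x x')" for x
  have q: "q (\<kappa> y) = (\<Sum>y'\<in>UNIV. (if J (\<kappa> y) (\<kappa> y') then 1 else 0) * P $ y $ y')" for y
    using sum_block_weights[OF Q, of "\<lambda>x'. if J (\<kappa> y) x' then 1 else 0" y] by (simp add: q_def)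
  have q_pos: "0 < q (\<kappa> y)" if yV: "y \<in> V" for y
  proof -
    obtain z where "z \<in> V" "z \<noteq> y" using V12 y2 by metis
    then obtain y' where y': "(y, y') \<in> R"
      using reach[OF yV \<open>z \<in> V\<close>] \<open>z \<noteq> y\<close> by (metis converse_rtranclE)
    then have "0 < P $ y $ y'" using edge_pos[OF P] by (auto simp: R_def)
    with y' show ?thesis unfolding q
      by (intro sum_pos2[of _ y']) (auto simp: R_def nonneg)
  qed
  have q_le: "q (\<kappa> y) \<le> 1" for y
  proof -
    have "q (\<kappa> y) \<le> (\<Sum>x'\<in>UNIV. Q (\<kappa> y) x')"
      unfolding q_def using Q0 by (intro sum_mono) auto
    then show ?thesis by (simp add: sumQ)
  qed

  have R_V: "R \<subseteq> V \<times> V" by (auto simp: R_def J_def V_def)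
  have R_pos: "0 < P $ y $ y'" if "(y, y') \<in> R" for y y'
    using edge_pos[OF P] that by (auto simp: R_def)
  \<comment> \<open>The reweighted matrices constructed below dominate \<open>P\<close> on \<open>R\<close>, so \<open>P\<close> can serve as the lower
      bound that is uniform in \<open>e\<close>. Only after \<open>C\<close> is fixed can \<open>e\<close> be chosen.\<close>
  obtain C where C: "C > 0" and bound: "\<And>e F u a b.
      almost_superharmonic V R (\<lambda>y y'. P $ y $ y') e F u \<Longrightarrow>
      a \<in> V \<Longrightarrow> u a = 1 \<Longrightarrow> b \<in> V \<Longrightarrow> u b \<le> 1 + C * e"
    by (rule almost_superharmonic_bound[where V = V and R = R and c = "\<lambda>y y'. P $ y $ y'"])
      (erule (1) reach, rule R_V, erule R_pos, rule that)

  have "((\<lambda>e. Z * (1 + C * e)\<^sup>2) \<longlongrightarrow> Z * (1 + C * 0)\<^sup>2) (at_right 0)"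
    by (intro tendsto_intros)
  then have "\<forall>\<^sub>F e in at_right 0. Z * (1 + C * e)\<^sup>2 < Q x0 x0'"
    using ZQ by (intro order_tendstoD(2)[of _ "Z * (1 + C * 0)\<^sup>2"]) auto
  moreover have "\<forall>\<^sub>F e in at_right 0. e \<in> {0<..<1::real}"
    by (rule eventually_at_right_real) simp
  ultimately have "\<exists>e. Z * (1 + C * e)\<^sup>2 < Q x0 x0' \<and> e \<in> {0<..<1}"
    by (intro eventually_happens'[OF trivial_limit_at_right_real] eventually_conj)
  then obtain e where e: "Z * (1 + C * e)\<^sup>2 < Q x0 x0'" "0 < e" "e < 1" by auto

  \<comment> \<open>With these block weights a row over \<open>T\<close> becomes the mixture of \<open>P\<close>, with weight \<open>e\<close>, and of \<open>P\<close>
      conditioned on the blocks in \<open>J\<close>, with weight \<open>1 - e\<close>. The block \<open>(x0, x0')\<close> is not in \<open>J\<close>,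
      so it gets the weight \<open>e\<close>.\<close>
  define g where "g x x' = (if x \<in> T then e + (1 - e) / q x * (if J x x' then 1 else 0) else 1)"
    for x x'
  have g_pos: "0 < g x x'" for x x'
  proof (cases "x \<in> T")
    case True
    obtain y where "\<kappa> y = x" using assms(3) by (metis surjD)
    then have "0 < q x" using q_pos True by (auto simp: V_def)
    then show ?thesis using e by (auto simp: g_def intro: add_pos_nonneg)
  qed (simp add: g_def)
  have g_sum: "(\<Sum>x'\<in>UNIV. g (\<kappa> y) x' * Q (\<kappa> y) x') = 1" for y
  proof (cases "y \<in> V")
    case True
    then have "(\<Sum>x'\<in>UNIV. g (\<kappa> y) x' * Q (\<kappa> y) x') =
        e * (\<Sum>x'\<in>UNIV. Q (\<kappa> y) x') + (1 - e) / q (\<kappa> y) * q (\<kappa> y)"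
      unfolding g_def q_def[of "\<kappa> y"] sum_distrib_left sum.distrib[symmetric]
      by (intro sum.cong) (auto simp: V_def algebra_simps)
    then show ?thesis using q_pos[OF True] by (simp add: sumQ)
  next
    case False
    then show ?thesis using sumQ by (simp add: g_def V_def)
  qed
  define P0 where "P0 = (\<chi> y y'. g (\<kappa> y) (\<kappa> y') * P $ y $ y')"
  define P1 where "P1 = (\<chi> y y'. g (\<kappa> y) (\<kappa> y') * P' $ y $ y')"
  have P01: "P0 \<in> lumpable E \<kappa>" "P1 \<in> lumpable E \<kappa>"
    unfolding P0_def P1_def using lumpable_reweight[OF P Q g_pos g_sum]
      lumpable_reweight[OF P' Q' g_pos g_sum] by auto
  define F where "F y y' = sqrt (P0 $ y $ y' * P1 $ y $ y')" for y y'
  obtain u0 s where u0: "\<And>y. 0 < u0 y" and s: "0 < s"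
    and mean: "(\<chi> y y'. sqrt (P0 $ y $ y' * P1 $ y $ y') * u0 y' / (s * u0 y)) \<in> lumpable E \<kappa>"
    by (rule e_family_geometric_mean[OF efam P01]) blast
  have lump0: "(\<chi> y y'. F y y' * u0 y' / (s * u0 y)) \<in> lumpable E \<kappa>"
    unfolding F_def by (rule mean)

  have F_eq: "F y y' = g (\<kappa> y) (\<kappa> y') * sqrt (P $ y $ y' * P' $ y $ y')" for y y'
    using g_pos[of "\<kappa> y" "\<kappa> y'"]
    by (simp add: F_def P0_def P1_def real_sqrt_mult mult_ac)
  have F_same: "F y y' = P0 $ y $ y'" if "(y, \<kappa> y') \<noteq> (y1, x0')" for y y'
    unfolding F_eq same[OF that] P0_def using nonneg by simp
  have F_nonneg: "0 \<le> F y y'" for y y'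
    unfolding F_eq using nonneg g_pos[of "\<kappa> y" "\<kappa> y'"] by simp
  have F_sum: "(\<Sum>y'\<in>UNIV. F y y') \<le> 1" for y
  proof -
    have st: "P0 \<in> stoch E" "P1 \<in> stoch E" using P01 by (auto simp: lumpable_def)
    have "(\<Sum>y'\<in>UNIV. F y y') \<le> (\<Sum>y'\<in>UNIV. (P0 $ y $ y' + P1 $ y $ y') / 2)"
      unfolding F_def using stoch_nonneg[OF st(1)] stoch_nonneg[OF st(2)]
      by (intro sum_mono arith_geo_mean_sqrt)
    also have "\<dots> = 1"
      using st by (simp add: stoch_def sum.distrib add_divide_distrib flip: sum_divide_distrib)
    finally show ?thesis .
  qed

  \<comment> \<open>The similarity is unaffected by scaling \<open>u0\<close>, so its minimum over \<open>V\<close> may be taken to be 1.\<close>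
  obtain a0 where a0: "a0 \<in> V" "\<And>y. y \<in> V \<Longrightarrow> u0 a0 \<le> u0 y"
    using V12 arg_min_if_finite[of V u0] by (metis empty_iff finite not_less)
  define u where "u y = u0 y / u0 a0" for y
  have u: "0 < u y" for y using u0 by (simp add: u_def)
  have "F y y' * u0 y' / (s * u0 y) = F y y' * u y' / (s * u y)" for y y'
    using u0[of a0] by (simp add: u_def)
  with lump0 have lump: "(\<chi> y y'. F y y' * u y' / (s * u y)) \<in> lumpable E \<kappa>" by simp
  have eig: "(\<Sum>y'\<in>UNIV. F y y' * u y') = s * u y" for y
  proof -
    have "(\<Sum>y'\<in>UNIV. F y y' * u y' / (s * u y)) = 1"
      using lump by (simp add: lumpable_def stoch_def)
    then show ?thesis using s u[of y] by (simp add: sum_divide_distrib[symmetric])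
  qed
  have Fu_nonneg: "0 \<le> F y y' * u y'" for y y'
    using F_nonneg[of y y'] u[of y'] by simp
  have "s \<le> 1" using eigenvalue_le_one[OF F_nonneg F_sum u eig] .

  have "almost_superharmonic V R (\<lambda>y y'. P $ y $ y') e F u"
    unfolding almost_superharmonic_def
  proof (safe)
    show "0 \<le> e" "\<And>y y'. 0 \<le> F y y'" using e F_nonneg by auto
  next
    fix y y' assume yy: "(y, y') \<in> R"
    then have y: "y \<in> V" "J (\<kappa> y) (\<kappa> y')" and ne: "(y, \<kappa> y') \<noteq> (y1, x0')"
      using R_V y1 by (auto simp: R_def J_def)
    have "1 - e \<le> (1 - e) / q (\<kappa> y)"
      using divide_left_mono[of "q (\<kappa> y)" 1 "1 - e"] q_pos[OF y(1)] q_le[of y] e by simp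
    then have "1 \<le> g (\<kappa> y) (\<kappa> y')" using y by (simp add: g_def V_def)
    then show "P $ y $ y' \<le> F y y'"
      unfolding F_same[OF ne] P0_def
      using mult_right_mono[of 1 "g (\<kappa> y) (\<kappa> y')" "P $ y $ y'"] nonneg(1)[of y y'] by simp
  next
    fix y assume y: "y \<in> V"
    have "1 - e = (\<Sum>y'\<in>UNIV. (1 - e) / q (\<kappa> y) * ((if J (\<kappa> y) (\<kappa> y') then 1 else 0) * P $ y $ y'))"
      unfolding sum_distrib_left[symmetric] q[symmetric] using q_pos[OF y] by simp
    also have "\<dots> = (\<Sum>y'\<in>V. (1 - e) / q (\<kappa> y) * ((if J (\<kappa> y) (\<kappa> y') then 1 else 0) * P $ y $ y'))"
      by (rule sum.mono_neutral_right) (auto simp: V_def J_def)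
    also have "\<dots> \<le> (\<Sum>y'\<in>V. F y y')"
    proof (rule sum_mono)
      fix y' assume "y' \<in> V"
      show "(1 - e) / q (\<kappa> y) * ((if J (\<kappa> y) (\<kappa> y') then 1 else 0) * P $ y $ y') \<le> F y y'"
      proof (cases "J (\<kappa> y) (\<kappa> y')")
        case True
        then have "F y y' = P0 $ y $ y'" using y1 by (intro F_same) (auto simp: J_def)
        then show ?thesis
          using True y e nonneg(1)[of y y'] by (simp add: P0_def g_def V_def distrib_right)
      qed (simp add: F_nonneg)
    qed
    finally show "1 - e \<le> (\<Sum>y'\<in>V. F y y')" .
  next
    fix y assume y: "y \<in> V"
    then show "1 \<le> u y" using a0 u0 by (simp add: u_def)
    have "(\<Sum>y'\<in>V. F y y' * u y') \<le> (\<Sum>y'\<in>UNIV. F y y' * u y')"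
      by (intro sum_mono2) (simp_all add: Fu_nonneg)
    also have "\<dots> \<le> u y" unfolding eig using \<open>s \<le> 1\<close> u[of y] by simp
    finally show "(\<Sum>y'\<in>V. F y y' * u y') \<le> u y" .
  qed
  note harm = this
  define B where "B = 1 + C * e"
  have uB: "1 \<le> u y" "u y \<le> B" if "y \<in> V" for y
    using harm bound[OF harm a0(1) _ that] that u0[of a0]
    by (auto simp: almost_superharmonic_def u_def B_def)
  have B: "1 \<le> B" using C e by (simp add: B_def)

  have fV: "fiber \<kappa> x0' \<subseteq> V" using T by (auto simp: fiber_def V_def)
  have g0: "g x0 x0' = e" using T by (simp add: g_def J_def)
  have g_fib: "g x0 (\<kappa> y') = e" if "y' \<in> fiber \<kappa> x0'" for y'
    using g0 that by (simp add: fiber_def)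
  \<comment> \<open>Compare the block sums of the rows \<open>y1\<close> and \<open>y2\<close>, where \<open>u\<close> varies only between 1 and \<open>B\<close>.\<close>
  obtain Q2 where "\<And>y x'. row_sum (\<chi> y y'. F y y' * u y' / (s * u y)) y (fiber \<kappa> x') = Q2 (\<kappa> y) x'"
    using lump unfolding lumpable_iff by blast
  then have "row_sum (\<chi> y y'. F y y' * u y' / (s * u y)) y1 (fiber \<kappa> x0')
      = row_sum (\<chi> y y'. F y y' * u y' / (s * u y)) y2 (fiber \<kappa> x0')"
    using y1 y2 by simp
  then have "(\<Sum>y'\<in>fiber \<kappa> x0'. F y1 y' * u y') / (s * u y1)
      = (\<Sum>y'\<in>fiber \<kappa> x0'. F y2 y' * u y') / (s * u y2)"
    by (simp add: row_sum_def sum_divide_distrib)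
  then have eq: "u y2 * (\<Sum>y'\<in>fiber \<kappa> x0'. F y1 y' * u y') = u y1 * (\<Sum>y'\<in>fiber \<kappa> x0'. F y2 y' * u y')"
    using s u[of y1] u[of y2] by (simp add: field_simps)
  have F1: "(\<Sum>y'\<in>fiber \<kappa> x0'. F y1 y') = e * Z"
    unfolding Z_def sum_distrib_left
    by (rule sum.cong) (auto simp: F_eq g_fib y1)
  have F2: "(\<Sum>y'\<in>fiber \<kappa> x0'. F y2 y') = e * Q x0 x0'"
  proof -
    have "Q x0 x0' = (\<Sum>y'\<in>fiber \<kappa> x0'. P $ y2 $ y')"
      using Q[of y2 x0'] y2 by (simp add: row_sum_def)
    then show ?thesis
      using y2 by (auto simp: F_same P0_def g_fib sum_distrib_left intro: sum.cong)
  qed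
  have "e * Q x0 x0' \<le> (\<Sum>y'\<in>fiber \<kappa> x0'. F y2 y' * u y')"
    unfolding F2[symmetric]
  proof (rule sum_mono)
    fix y' assume "y' \<in> fiber \<kappa> x0'"
    then have "F y2 y' * 1 \<le> F y2 y' * u y'"
      using fV uB(1) by (intro mult_left_mono F_nonneg) auto
    then show "F y2 y' \<le> F y2 y' * u y'" by simp
  qed
  also have "\<dots> \<le> u y1 * (\<Sum>y'\<in>fiber \<kappa> x0'. F y2 y' * u y')"
    using mult_right_mono[OF uB(1)[OF V12(1)], of "\<Sum>y'\<in>fiber \<kappa> x0'. F y2 y' * u y'"]
    by (simp add: sum_nonneg Fu_nonneg)
  also have "\<dots> = u y2 * (\<Sum>y'\<in>fiber \<kappa> x0'. F y1 y' * u y')" by (rule eq[symmetric])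
  also have "\<dots> \<le> B * (\<Sum>y'\<in>fiber \<kappa> x0'. F y1 y' * B)"
  proof (rule mult_mono)
    show "(\<Sum>y'\<in>fiber \<kappa> x0'. F y1 y' * u y') \<le> (\<Sum>y'\<in>fiber \<kappa> x0'. F y1 y' * B)"
      using fV uB(2) by (intro sum_mono mult_left_mono F_nonneg) auto
  qed (use uB(2)[OF V12(2)] B in \<open>simp_all add: sum_nonneg Fu_nonneg\<close>)
  also have "\<dots> = e * (Z * B\<^sup>2)"
    unfolding sum_distrib_right[symmetric] F1 by (simp add: power2_eq_square)
  finally have "Q x0 x0' \<le> Z * B\<^sup>2" using e by simp
  with e(1) show False by (simp add: B_def)
qed

end
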